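(* For complex $a,b,m,x$, $$\sum_{n=0}^{\infty}\frac{\bigl(xe^{-bx}\bigr)^n(a+bn)^{n-m}}{(n-m)!}=\frac{e^{ax}x^m}{1-bx}.$$
   Context: Here $s!=\Gamma(s+1)$ with $\Gamma$ the Euler gamma function, and $1/s!=0$ when $s$ is a negative integer.
   Formalization: The identity is proved for m a natural number and for x with |bx e^{1-bx}| ≤ 1 and |bx| < 1; as printed for all complex m it fails (a=1, b=0, x=1, m=-1 gives e-1 against e), and for other x the series diverges or takes the value of another branch. *)

theory Defs
  imports "HOL-Complex_Analysis.Complex_Analysis"
begin

(* s! for complex s.  HOL's Gamma is 0 at its poles and division by 0 gives 0, so
   1 / cfact s = 0 for every negative integer s, which is the required convention;
   see inverse_cfact and inverse_cfact_neg_int. *)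
definition cfact :: "complex \<Rightarrow> complex" where
  "cfact s = Gamma (s + 1)"

(* Principal complex power, with w^0 = 1 also for w = 0 (HOL has 0 powr 0 = 0). *)
definition cpow :: "complex \<Rightarrow> complex \<Rightarrow> complex" where
  "cpow w s = (if s = 0 then 1 else w powr s)"

lemma inverse_cfact: "1 / cfact s = rGamma (s + 1)"
  by (simp add: cfact_def rGamma_inverse_Gamma field_simps)

lemma inverse_cfact_neg_int: "1 / cfact (- of_nat (Suc k)) = 0"
  unfolding inverse_cfact by (simp add: rGamma_eq_zero_iff)

lemma cfact_of_nat: "cfact (of_nat k) = fact k"
  by (simp add: cfact_def Gamma_fact add.commute)

lemma cpow_of_nat: "cpow w (of_nat k) = w ^ k"
  by (cases "w = 0") (auto simp: cpow_def powr_nat)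

end

theory Submission imports Defs begin

text \<open>
  Rescaling reduces everything to \<open>b = 1\<close>, \<open>m = 0\<close>. By Cauchy's formula, with \<open>z = u e\<^sup>-\<^sup>u\<close> and
  \<open>q(s) = z e\<^sup>s / s\<close>, the \<open>j\<close>-th term is the integral of \<open>e\<^bsup>\<alpha>s\<^esup> q(s)\<^sup>j / (2\<pi>i s)\<close> over the unit circle.
  Summing the geometric progression, a partial sum is the integral of
  \<open>e\<^bsup>\<alpha>s\<^esup> / (2\<pi>i (s - z e\<^sup>s))\<close>, minus a remainder carrying the factor \<open>q(s)\<^sup>N\<close>. The only pole in the closed
  disc is \<open>s = u\<close>, because \<open>s e\<^sup>-\<^sup>s\<close> is injective there, and its residue is the right-hand side.
  On the circle \<open>|q(s)| = |u e\<^bsup>1-u\<^esup>| e\<^bsup>Re s - 1\<^esup>\<close> is at most 1, and less than 1 for \<open>s \<noteq> 1\<close>,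
  so the remainder vanishes by dominated convergence, even where the series converges only
  conditionally.
\<close>

section \<open>Injectivity of \<open>s * exp (- s)\<close> on the unit disc\<close>

lemma norm_exp_minus_1_le:
  fixes d :: complex
  assumes "Re d \<le> 0"
  shows "norm (exp d - 1) \<le> norm d"
proof -
  \<comment> \<open>\<open>exp\<close> is its own derivative and has norm at most 1 on the left
    half-plane, which is convex.\<close>
  have "norm (exp d - exp 0) \<le> 1 * norm (d - 0)"
  proof (rule field_differentiable_bound)
    show "convex {z. Re z \<le> 0}" by (rule convex_halfspace_Re_le)
  qed (use assms in \<open>auto intro!: derivative_eq_intros\<close>)
  then show ?thesis by simp
qed

text \<open>Strictness comes from the difference of squares of \<open>exp (d / 2)\<close> and
  \<open>1\<close>: the factor \<open>exp (d / 2) + 1\<close> has norm below 2.\<close>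

lemma norm_exp_minus_1_less:
  fixes d :: complex
  assumes "Re d < 0"
  shows "norm (exp d - 1) < norm d"
proof -
  have "d \<noteq> 0" using assms by auto
  have "norm (exp (d / 2) + 1) \<le> norm (exp (d / 2)) + 1"
    using norm_triangle_ineq[of "exp (d / 2)" 1] by simp
  also have "\<dots> < 2" using assms by simp
  finally have less: "norm (exp (d / 2) + 1) < 2" .
  have "exp (d / 2) ^ 2 = exp d" by (simp flip: exp_double)
  then have "(exp (d / 2) - 1) * (exp (d / 2) + 1) = exp d - 1"
    by (simp add: algebra_simps power2_eq_square)
  then have "norm (exp d - 1) = norm (exp (d / 2) - 1) * norm (exp (d / 2) + 1)"
    by (metis norm_mult)
  also have "\<dots> \<le> norm (d / 2) * norm (exp (d / 2) + 1)"
    using norm_exp_minus_1_le[of "d / 2"] assms by (intro mult_right_mono) auto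
  also have "\<dots> < norm (d / 2) * 2"
    using less \<open>d \<noteq> 0\<close> by (intro mult_strict_left_mono) auto
  finally show ?thesis by (simp add: norm_divide)
qed

lemma inj_mult_exp_minus_unit_disc:
  fixes s u :: complex
  assumes s: "norm s \<le> 1" and u: "norm u < 1" and eq: "s = u * exp (s - u)"
  shows "s = u"
proof (rule ccontr)
  assume "s \<noteq> u"
  then have pos: "norm (s - u) > 0" by simp
  have "u = s * exp (u - s)"
    using arg_cong[OF eq, of "\<lambda>t. t * exp (u - s)"] by (simp add: mult.assoc flip: exp_add)
  then have "u - s = s * exp (u - s) - s" by (rule arg_cong)
  then have "u - s = s * (exp (u - s) - 1)" by (simp only: right_diff_distrib mult_1_right)
  then have eq1: "norm (s - u) = norm s * norm (exp (u - s) - 1)"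
    by (metis norm_minus_commute norm_mult)
  have "s - u = u * exp (s - u) - u" using eq by (rule arg_cong)
  then have "s - u = u * (exp (s - u) - 1)" by (simp only: right_diff_distrib mult_1_right)
  then have eq2: "norm (s - u) = norm u * norm (exp (s - u) - 1)"
    by (metis norm_mult)
  show False
  \<comment> \<open>The exponential bounds apply to whichever of \<open>s - u\<close>,
    \<open>u - s\<close> lies in the left half-plane. Strictness comes from
    \<open>norm u < 1\<close> in the first case; in the second \<open>norm s = 1\<close> is allowed,
    so the exponential bound itself must be strict.\<close>
  proof (cases "Re (s - u) \<le> 0")
    case True
    have "norm (s - u) \<le> norm u * norm (s - u)"
      by (subst eq2) (intro mult_left_mono norm_exp_minus_1_le True norm_ge_zero)
    then show False using u pos by (simp add: mult_le_cancel_right2)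
  next
    case False
    then have "norm (exp (u - s) - 1) < norm (s - u)"
      using norm_exp_minus_1_less[of "u - s"] by (simp add: norm_minus_commute)
    moreover have "norm s * norm (exp (u - s) - 1) \<le> norm (exp (u - s) - 1)"
      using s by (simp add: mult_left_le_one_le)
    ultimately show False using eq1 by linarith
  qed
qed

section \<open>Vanishing of the remainder integral\<close>

lemma contour_integral_power_tendsto_0:
  fixes G q :: "complex \<Rightarrow> complex"
  assumes G: "continuous_on (sphere 0 1) G"
    and int: "\<And>N. ((\<lambda>s. G s * q s ^ N) has_contour_integral I N) (circlepath 0 1)"
    and le: "\<And>s. norm s = 1 \<Longrightarrow> norm (q s) \<le> 1"
    and less: "\<And>s. norm s = 1 \<Longrightarrow> s \<noteq> 1 \<Longrightarrow> norm (q s) < 1"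
  shows "I \<longlonglongrightarrow> 0"
proof -
  define f where "f N t = G (circlepath 0 1 t) * q (circlepath 0 1 t) ^ N
    * vector_derivative (circlepath 0 1) (at t)" for N t
  have nrm: "norm (circlepath 0 1 t) = 1" for t
    by (simp add: circlepath)
  have "(f N has_integral I N) {0..1}" for N
    using int[of N] unfolding has_contour_integral f_def .
  \<comment> \<open>At both endpoints \<open>circlepath 0 1\<close> equals \<open>1\<close>, where
    \<open>less\<close> says nothing; on the open interval convergence is pointwise
    everywhere.\<close>
  then have f: "(f N has_integral I N) {0<..<1}" for N
    by (simp add: has_integral_Icc_iff_Ioo)
  have "compact (G ` sphere 0 1)" using G by (intro compact_continuous_image) auto
  then have "bounded (G ` sphere 0 1)" by (rule compact_imp_bounded)
  then obtain B where B: "norm (G s) \<le> B" if "norm s = 1" for s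
    unfolding bounded_iff by fastforce
  have "(\<lambda>N. integral {0<..<1} (f N)) \<longlonglongrightarrow> integral {0<..<1::real} (\<lambda>_. 0 :: complex)"
  proof (rule dominated_convergence(2))
    show "f N integrable_on {0<..<1}" for N using f by blast
    \<comment> \<open>The factor \<open>2 * pi\<close> is the speed of
      \<open>circlepath 0 1\<close>.\<close>
    show "(\<lambda>_. B * (2 * pi)) integrable_on {0<..<1::real}"
      using integrable_on_open_interval_real[of "\<lambda>_. B * (2 * pi)" 0 1] by auto
    show "norm (f N t) \<le> B * (2 * pi)" for N t
    proof -
      have "norm (f N t) = norm (G (circlepath 0 1 t)) * norm (q (circlepath 0 1 t)) ^ N * (2 * pi)"
        by (simp add: f_def norm_mult norm_power vector_derivative_circlepath)
      also have "\<dots> \<le> B * 1 * (2 * pi)"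
        using B[OF nrm] le[OF nrm] by (intro mult_mono power_le_one) (auto intro: order_trans[OF norm_ge_zero])
      finally show ?thesis by simp
    qed
    show "(\<lambda>N. f N t) \<longlonglongrightarrow> 0" if t: "t \<in> {0<..<1}" for t
    proof -
      have "circlepath 0 1 t \<noteq> 1"
      proof
        assume "circlepath 0 1 t = 1"
        then have "exp (2 * of_real pi * \<i> * of_real t) = 1" by (simp add: circlepath)
        then obtain n :: int where "2 * pi * t = of_int (2 * n) * pi"
          by (auto simp: exp_eq_1)
        then have "t = of_int n" by simp
        then show False using t by auto
      qed
      from less[OF nrm this] have "(\<lambda>N. q (circlepath 0 1 t) ^ N) \<longlonglongrightarrow> 0"
        by (rule LIMSEQ_power_zero)
      then show ?thesis unfolding f_def
        by (intro tendsto_mult_left_zero tendsto_mult_right_zero)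
    qed
  qed
  moreover have "integral {0<..<1} (f N) = I N" for N
    using f by (rule integral_unique)
  ultimately show ?thesis by simp
qed

section \<open>Contour integrals of the terms and of the full kernel\<close>

lemma higher_deriv_exp_cmult: "(deriv ^^ k) (\<lambda>s. exp (c * s)) = (\<lambda>s. c ^ k * exp (c * s :: complex))"
proof (induction k)
  case (Suc k)
  have "deriv (\<lambda>s. c ^ k * exp (c * s)) s = c ^ Suc k * exp (c * s)" for s
    by (rule DERIV_imp_deriv) (auto intro!: derivative_eq_intros)
  then show ?case using Suc by auto
qed auto

lemma has_contour_integral_exp_over_power:
  fixes \<alpha> z :: complex
  shows "((\<lambda>s. exp (\<alpha> * s) / s * (z * exp s / s) ^ j) has_contour_integral
    2 * pi * \<i> * (z ^ j * (\<alpha> + of_nat j) ^ j / fact j)) (circlepath 0 1)"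
proof -
  define c where "c = \<alpha> + of_nat j"
  have "((\<lambda>s. exp (c * s) / (s - 0) ^ Suc j) has_contour_integral
      2 * pi * \<i> / fact j * (deriv ^^ j) (\<lambda>s. exp (c * s)) 0) (circlepath 0 1)"
    by (rule Cauchy_has_contour_integral_higher_derivative_circlepath)
      (auto intro!: continuous_intros holomorphic_intros)
  from has_contour_integral_lmul[OF this, of "z ^ j"]
  have "((\<lambda>s. z ^ j * (exp (c * s) / s ^ Suc j)) has_contour_integral
    2 * pi * \<i> * (z ^ j * c ^ j / fact j)) (circlepath 0 1)"
    unfolding higher_deriv_exp_cmult by (simp add: mult_ac)
  moreover have "z ^ j * (exp (c * s) / s ^ Suc j) = exp (\<alpha> * s) / s * (z * exp s / s) ^ j" for s
    by (simp add: c_def power_mult_distrib power_divide distrib_right exp_add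
        flip: exp_of_nat_mult)
  ultimately show ?thesis by (simp add: c_def)
qed

lemma has_contour_integral_exp_residue:
  fixes \<alpha> u :: complex
  assumes u: "norm u < 1"
  shows "((\<lambda>s. exp (\<alpha> * s) / (s - u * exp (s - u))) has_contour_integral
    2 * pi * \<i> * (exp (\<alpha> * u) / (1 - u))) (circlepath 0 1)"
proof -
  define k where "k s = s - u * exp (s - u)" for s
  \<comment> \<open>\<open>h\<close> is \<open>k\<close> with its simple zero at \<open>u\<close>
    divided out. It has no zeros on the closed disc, so Cauchy's formula applies to
    \<open>exp (\<alpha> * s) / h s\<close>.\<close>
  define h where "h s = (if s = u then deriv k u else (k s - k u) / (s - u))" for s
  have k0: "k u = 0" by (simp add: k_def)
  have knz: "k s \<noteq> 0" if "norm s \<le> 1" "s \<noteq> u" for s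
    using inj_mult_exp_minus_unit_disc[OF that(1) u] that(2) by (auto simp: k_def)
  have dk: "deriv k u = 1 - u" unfolding k_def
    by (rule DERIV_imp_deriv) (auto intro!: derivative_eq_intros)
  have "h holomorphic_on UNIV" unfolding h_def
    by (rule pole_lemma_open) (auto simp: k_def [abs_def] intro!: holomorphic_intros)
  moreover have nz: "h s \<noteq> 0" if "norm s \<le> 1" for s
    using knz[OF that] u by (auto simp: h_def k0 dk)
  ultimately have hol: "(\<lambda>s. exp (\<alpha> * s) / h s) holomorphic_on cball 0 1"
    by (auto intro!: holomorphic_intros intro: holomorphic_on_subset)
  have "((\<lambda>s. exp (\<alpha> * s) / h s / (s - u)) has_contour_integral
      2 * of_real pi * \<i> * (exp (\<alpha> * u) / h u)) (circlepath 0 1)"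
    using u by (intro Cauchy_integral_circlepath holomorphic_on_imp_continuous_on[OF hol]
        holomorphic_on_subset[OF hol]) auto
  then have "((\<lambda>s. exp (\<alpha> * s) / h s / (s - u)) has_contour_integral
      2 * pi * \<i> * (exp (\<alpha> * u) / (1 - u))) (circlepath 0 1)"
    by (simp add: h_def dk)
  then show ?thesis
    by (rule has_contour_integral_eq) (use u in \<open>auto simp: h_def k0 k_def\<close>)
qed

section \<open>Summation of the normalized series\<close>

lemma sums_power_exp_normalized:
  fixes \<alpha> u :: complex
  assumes u: "norm u < 1" and conv: "norm (u * exp (1 - u)) \<le> 1"
  shows "(\<lambda>j. (u * exp (- u)) ^ j * (\<alpha> + of_nat j) ^ j / fact j) sums (exp (\<alpha> * u) / (1 - u))"
proof -
  define z where "z = u * exp (- u)"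
  define q where "q s = z * exp s / s" for s
  define G where "G s = exp (\<alpha> * s) / (s - u * exp (s - u))" for s
  define L where "L = exp (\<alpha> * u) / (1 - u)"
  define S where "S N = (\<Sum>j<N. z ^ j * (\<alpha> + of_nat j) ^ j / fact j)" for N
  have zexp: "z * exp s = u * exp (s - u)" for s
    by (simp add: z_def exp_diff exp_minus field_simps)
  have nz: "s - u * exp (s - u) \<noteq> 0" if "norm s = 1" for s
    using inj_mult_exp_minus_unit_disc[of s u] that u by auto
  have eq: "G s - (\<Sum>j<N. exp (\<alpha> * s) / s * q s ^ j) = G s * q s ^ N" if "norm s = 1" for s N
  proof -
    have "s \<noteq> 0" using that by auto
    then have sq: "s - u * exp (s - u) = s * (1 - q s)"
      by (simp add: q_def zexp right_diff_distrib)
    \<comment> \<open>This covers \<open>s = 1\<close> too, where \<open>q s\<close> may have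
      modulus 1.\<close>
    then have "q s \<noteq> 1" using nz[OF that] by auto
    then have "(\<Sum>j<N. exp (\<alpha> * s) / s * q s ^ j) = exp (\<alpha> * s) / s * ((1 - q s ^ N) / (1 - q s))"
      by (subst sum_distrib_left [symmetric]) (simp add: sum_gp_strict)
    also have "\<dots> = G s * (1 - q s ^ N)" by (simp add: G_def sq)
    finally show ?thesis by (simp add: algebra_simps)
  qed
  have int: "((\<lambda>s. G s * q s ^ N) has_contour_integral 2 * pi * \<i> * (L - S N)) (circlepath 0 1)" for N
  proof -
    have "((\<lambda>s. G s - (\<Sum>j<N. exp (\<alpha> * s) / s * q s ^ j)) has_contour_integral
      2 * pi * \<i> * L - (\<Sum>j<N. 2 * pi * \<i> * (z ^ j * (\<alpha> + of_nat j) ^ j / fact j))) (circlepath 0 1)"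
      unfolding G_def L_def q_def using u
      by (intro has_contour_integral_diff has_contour_integral_sum has_contour_integral_exp_residue
          has_contour_integral_exp_over_power) auto
    then have "((\<lambda>s. G s * q s ^ N) has_contour_integral
      2 * pi * \<i> * L - (\<Sum>j<N. 2 * pi * \<i> * (z ^ j * (\<alpha> + of_nat j) ^ j / fact j))) (circlepath 0 1)"
      by (rule has_contour_integral_eq) (simp add: eq del: times_divide_eq_left)
    then show ?thesis by (simp add: S_def right_diff_distrib sum_distrib_left)
  qed
  have nq: "norm (q s) = norm (u * exp (1 - u)) * exp (Re s - 1)" if "norm s = 1" for s
    using that by (simp add: q_def zexp norm_divide norm_mult flip: exp_add)
  have "(\<lambda>N. 2 * pi * \<i> * (L - S N)) \<longlonglongrightarrow> 0"
  proof (rule contour_integral_power_tendsto_0[where q = q, OF _ int])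
    show "continuous_on (sphere 0 1) G" unfolding G_def using nz
      by (auto intro!: continuous_intros)
    fix s :: complex assume s: "norm s = 1"
    have "Re s \<le> 1" using complex_Re_le_cmod[of s] s by simp
    then show "norm (q s) \<le> 1" unfolding nq[OF s] using conv by (intro mult_le_one) auto
    assume "s \<noteq> 1"
    have "Re s \<noteq> 1"
    proof
      assume "Re s = 1"
      moreover from this have "Im s = 0" using s by (simp add: cmod_def)
      ultimately show False using \<open>s \<noteq> 1\<close> by (simp add: complex_eq_iff)
    qed
    with \<open>Re s \<le> 1\<close> have "exp (Re s - 1) < 1" by simp
    moreover have "norm (u * exp (1 - u)) * exp (Re s - 1) \<le> exp (Re s - 1)"
      using conv by (intro mult_left_le_one_le) auto
    ultimately show "norm (q s) < 1" unfolding nq[OF s] by linarith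
  qed
  from tendsto_mult_left[OF this, of "1 / (2 * pi * \<i>)"]
  have "(\<lambda>N. L - S N) \<longlonglongrightarrow> 0" by simp
  from tendsto_diff[OF tendsto_const[of L] this] show ?thesis
    by (simp add: sums_def S_def L_def z_def)
qed

section \<open>Rescaling and index shift\<close>

lemma sums_power_exp:
  fixes A b x :: complex
  assumes conv: "norm (b * x * exp (1 - b * x)) \<le> 1" and branch: "norm (b * x) < 1"
  shows "(\<lambda>j. (x * exp (- (b * x))) ^ j * (A + b * of_nat j) ^ j / fact j)
    sums (exp (A * x) / (1 - b * x))"
proof (cases "b = 0")
  case True
  then show ?thesis
    using exp_converges[of "A * x"] by (simp add: scaleR_conv_of_real field_simps)
next
  case False
  \<comment> \<open>With \<open>u = b * x\<close> and \<open>\<alpha> = A / b\<close>, the factor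
    \<open>b ^ j\<close> moves from one power to the other.\<close>
  have "(b * x * exp (- (b * x))) ^ j * (A / b + of_nat j) ^ j
      = (x * exp (- (b * x))) ^ j * (A + b * of_nat j) ^ j" for j
    using False by (simp add: field_simps flip: power_mult_distrib)
  then show ?thesis
    using sums_power_exp_normalized[OF branch conv, of "A / b"] False by (simp add: mult_ac)
qed

text \<open>The series sees \<open>x\<close> only through \<open>x * exp (- (b * x))\<close>, a
  value shared by other points when \<open>b\<close> and \<open>x\<close> are nonzero;
  \<open>branch\<close> singles out the one with \<open>b * x\<close> in the unit disc.\<close>

theorem proposition3p43:
  fixes a b m x :: complex
  assumes m: "m \<in> \<nat>"
    and conv: "norm (b * x * exp (1 - b * x)) \<le> 1"
    and branch: "norm (b * x) < 1"
  shows "(\<lambda>n. (x * exp (- (b * x))) ^ n * cpow (a + b * of_nat n) (of_nat n - m)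
               / cfact (of_nat n - m))
         sums (exp (a * x) * cpow x m / (1 - b * x))"
proof -
  from m obtain k where k: "m = of_nat k" by (elim Nats_cases)
  define f where "f n = (x * exp (- (b * x))) ^ n * cpow (a + b * of_nat n) (of_nat n - m)
               / cfact (of_nat n - m)" for n
  define z where "z = x * exp (- (b * x))"
  have zero: "f n = 0" if "n < k" for n
  proof -
    obtain i where "k = n + Suc i" using \<open>n < k\<close> less_iff_Suc_add by auto
    then have "of_nat n - m = - of_nat (Suc i)" by (simp add: k)
    then have "1 / cfact (of_nat n - m) = 0" by (metis inverse_cfact_neg_int)
    then show ?thesis by (simp add: f_def)
  qed
  \<comment> \<open>Past the vanishing terms this is the series for \<open>m = 0\<close>, with
    \<open>a\<close> replaced by \<open>a + b * of_nat k\<close>.\<close>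
  have shift: "f (j + k) = z ^ k * (z ^ j * (a + b * of_nat k + b * of_nat j) ^ j / fact j)" for j
  proof -
    have "of_nat (j + k) - m = of_nat j" by (simp add: k)
    then show ?thesis
      by (simp add: f_def z_def cfact_of_nat cpow_of_nat power_add algebra_simps)
  qed
  have "(\<lambda>j. f (j + k)) sums (z ^ k * (exp ((a + b * of_nat k) * x) / (1 - b * x)))"
    unfolding shift z_def by (intro sums_mult sums_power_exp conv branch)
  \<comment> \<open>The exponential in \<open>z ^ k\<close> cancels the one created by the shift of
    \<open>a\<close>.\<close>
  moreover have "z ^ k * exp ((a + b * of_nat k) * x) = exp (a * x) * x ^ k"
    by (simp add: z_def power_mult_distrib distrib_right exp_add exp_minus
        field_simps flip: exp_of_nat_mult)
  ultimately have "(\<lambda>j. f (j + k)) sums (exp (a * x) * x ^ k / (1 - b * x))" by simp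
  then have "f sums (exp (a * x) * x ^ k / (1 - b * x))"
    by (simp add: sums_iff_shift zero)
  then show ?thesis by (simp add: f_def [abs_def] k cpow_of_nat)
qed

end
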